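(* Let $n$ be a positive integer. Let $b_1,\dots,b_n$ be nonzero complex numbers such that $b_{n+1-i}=\overline{b_i}$ for all $i=1,\dots,n$. Let $z_1,\dots,z_n$ be distinct complex numbers with $|z_i|=1$ and $z_i\neq 1$ for all $i$, such that $z_{n+1-i}=\overline{z_i}$ for all $i=1,\dots,n$. Then $$\liminf_{k\to\infty}\sum_{j=1}^n b_j z_j^k\le -\frac{\sum_{j=1}^n|b_j|^2}{\sum_{j=1}^n|b_j|}.$$
   Context: Here $k$ runs through the positive integers. The sum $\sum_{j=1}^n b_jz_j^k$ is real for every integer $k$ because of the conjugacy conditions. *)

theory Defs
  imports Complex_Main "HOL-Library.Extended_Real"
begin

(* Justifies taking the real part in order to form the liminf. *)
lemma conjugate_symmetric_power_sum_real:
  fixes n :: nat and b z :: "nat \<Rightarrow> complex"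
  assumes "\<And>i. i \<in> {1..n} \<Longrightarrow> b (n + 1 - i) = cnj (b i)"
    and "\<And>i. i \<in> {1..n} \<Longrightarrow> z (n + 1 - i) = cnj (z i)"
  shows "(\<Sum>j=1..n. b j * z j ^ k) \<in> \<real>"
proof -
  have "(\<Sum>j=1..n. b j * z j ^ k) = (\<Sum>j=1..n. b (n + 1 - j) * z (n + 1 - j) ^ k)"
    by (rule sum.atLeastAtMost_rev[of _ 1 n, simplified add.commute[of 1 n]])
  also have "\<dots> = cnj (\<Sum>j=1..n. b j * z j ^ k)"
    unfolding cnj_sum using assms by (intro sum.cong) auto
  finally show ?thesis
    by (simp add: Reals_cnj_iff)
qed

end

theory Submission
  imports Defs
begin

text \<open>
  The proof compares long-run averages.  Write \<open>f k\<close> for the exponential sum,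
  \<open>B = (\<Sum>j. \<bar>b\<^sub>j\<bar>)\<close> and \<open>S = (\<Sum>j. \<bar>b\<^sub>j\<bar>\<^sup>2)\<close>.  For \<open>w\<close> on the unit circle the
  sequence \<open>w ^ k\<close> has average 1 if \<open>w = 1\<close> and average 0 otherwise, because its partial
  sums are bounded in the second case (\<open>has_mean_power\<close>).  Since no \<open>z\<^sub>j\<close> equals 1, the
  average of \<open>f\<close> is therefore 0; and since the \<open>z\<^sub>j\<close> are distinct, only the diagonal terms of
  \<open>\<bar>f k\<bar>\<^sup>2 = (\<Sum>i j. b\<^sub>i * cnj b\<^sub>j * (z\<^sub>i * cnj z\<^sub>j) ^ k)\<close> survive averaging, so the average of
  \<open>f\<^sup>2\<close> is \<open>S\<close>.

  The triangle inequality gives \<open>f \<le> B\<close>.  If also \<open>f \<ge> d\<close> from some point on, then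
  \<open>(f - d) * (B - f)\<close> is eventually nonnegative, hence so is its average, which is
  \<open>- S - d * B\<close>.  Thus every eventual lower bound satisfies \<open>d \<le> - S / B\<close>, which is the
  assertion about the limit inferior.  The conjugacy conditions enter only through the fact
  that \<open>f\<close> takes real values.
\<close>

definition has_mean :: "(nat \<Rightarrow> 'a::real_normed_field) \<Rightarrow> 'a \<Rightarrow> bool" where
  "has_mean g L \<longleftrightarrow> (\<lambda>N. (\<Sum>k<N. g k) / of_nat N) \<longlonglongrightarrow> L"

lemma has_mean_const: "has_mean (\<lambda>_. c) c"
proof -
  have "\<forall>\<^sub>F N in sequentially. c = (\<Sum>k<N. c) / of_nat N"
    using eventually_gt_at_top[of 0] by eventually_elim simp
  then show ?thesis
    unfolding has_mean_def using tendsto_const by (rule Lim_transform_eventually[rotated])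
qed

lemma has_mean_add:
  assumes "has_mean g L" "has_mean h M"
  shows "has_mean (\<lambda>k. g k + h k) (L + M)"
  using tendsto_add[OF assms[unfolded has_mean_def]]
  by (simp add: has_mean_def sum.distrib add_divide_distrib)

lemma has_mean_cmult:
  assumes "has_mean g L"
  shows "has_mean (\<lambda>k. c * g k) (c * L)"
  using tendsto_mult_left[OF assms[unfolded has_mean_def], of c]
  by (simp add: has_mean_def sum_distrib_left)

lemma has_mean_sum:
  assumes "\<And>a. a \<in> A \<Longrightarrow> has_mean (g a) (L a)"
  shows "has_mean (\<lambda>k. \<Sum>a\<in>A. g a k) (\<Sum>a\<in>A. L a)"
  using assms
  by (induction A rule: infinite_finite_induct) (auto intro: has_mean_const has_mean_add)

lemma has_mean_Re:
  assumes "has_mean g L"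
  shows "has_mean (\<lambda>k. Re (g k)) (Re L)"
  using tendsto_Re[OF assms[unfolded has_mean_def]]
  by (simp add: has_mean_def)

text \<open>
  The finitely many terms before the sequence becomes nonnegative contribute a fixed amount
  to the partial sums, which disappears after division by the length.
\<close>

lemma has_mean_nonneg:
  fixes g :: "nat \<Rightarrow> real"
  assumes "has_mean g L" and "\<forall>\<^sub>F k in sequentially. 0 \<le> g k"
  shows "0 \<le> L"
proof -
  obtain K where K: "\<And>k. k \<ge> K \<Longrightarrow> 0 \<le> g k"
    using assms(2) by (auto simp: eventually_sequentially)
  have "(\<Sum>k<K. g k) / real N \<le> (\<Sum>k<N. g k) / real N" if "N \<ge> K" for N
    using that K by (intro divide_right_mono sum_mono2) auto
  moreover have "(\<lambda>N. (\<Sum>k<K. g k) / real N) \<longlonglongrightarrow> 0"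
    by (rule lim_const_over_n)
  ultimately show ?thesis
    using assms(1) unfolding has_mean_def by (blast intro: LIMSEQ_le)
qed

text \<open>
  For \<open>w \<noteq> 1\<close> the geometric sum formula bounds all partial sums by \<open>2 / \<bar>w - 1\<bar>\<close>.
\<close>

lemma has_mean_power:
  fixes w :: complex
  assumes "cmod w = 1"
  shows "has_mean (\<lambda>k. w ^ k) (if w = 1 then 1 else 0)"
proof (cases "w = 1")
  case True
  then show ?thesis
    using has_mean_const[of 1] by simp
next
  case False
  have "cmod ((\<Sum>k<N. w ^ k) / of_nat N) \<le> 2 / cmod (w - 1) / real N" for N
  proof -
    have "cmod (w ^ N - 1) \<le> 2"
      using norm_triangle_ineq4[of "w ^ N" 1] by (simp add: norm_power assms)
    then show ?thesis
      using False by (simp add: geometric_sum norm_divide norm_mult divide_right_mono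
          flip: divide_divide_eq_left)
  qed
  then have "(\<lambda>N. (\<Sum>k<N. w ^ k) / of_nat N) \<longlonglongrightarrow> 0"
    by (intro tendsto_0_le[OF lim_const_over_n[of "2 / cmod (w - 1)"], where K = 1]
        always_eventually) simp
  then show ?thesis
    using False by (simp add: has_mean_def)
qed

lemma has_mean_exponential_sum:
  fixes c w :: "'a \<Rightarrow> complex"
  assumes "\<And>a. a \<in> A \<Longrightarrow> cmod (w a) = 1"
  shows "has_mean (\<lambda>k. \<Sum>a\<in>A. c a * w a ^ k) (\<Sum>a\<in>A. c a * (if w a = 1 then 1 else 0))"
  using assms by (intro has_mean_sum has_mean_cmult has_mean_power)

text \<open>
  Parseval's identity for almost periodic sequences: on the unit circle \<open>z i * cnj (z j) = 1\<close>
  means \<open>z i = z j\<close>, so distinct frequencies are orthogonal with respect to averaging.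
\<close>

lemma has_mean_norm_square_exponential_sum:
  fixes b z :: "'a \<Rightarrow> complex"
  assumes "finite A" and inj: "inj_on z A" and unit: "\<And>j. j \<in> A \<Longrightarrow> cmod (z j) = 1"
  defines "f \<equiv> (\<lambda>k::nat. \<Sum>j\<in>A. b j * z j ^ k)"
  shows "has_mean (\<lambda>k. f k * cnj (f k)) (of_real (\<Sum>j\<in>A. (cmod (b j))\<^sup>2))"
proof -
  let ?c = "\<lambda>(i, j). b i * cnj (b j)" and ?w = "\<lambda>(i, j). z i * cnj (z j)"
  have diag: "z i * cnj (z j) = 1 \<longleftrightarrow> i = j" if "i \<in> A" "j \<in> A" for i j
  proof
    assume *: "z i * cnj (z j) = 1"
    have "z i = z i * (z j * cnj (z j))"
      using complex_norm_square[of "z j"] unit[OF that(2)] by simp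
    also have "\<dots> = (z i * cnj (z j)) * z j"
      by (simp only: mult_ac)
    finally have "z i = z j"
      by (simp only: * mult_1)
    then show "i = j"
      using inj that by (auto dest: inj_onD)
  next
    assume "i = j"
    then show "z i * cnj (z j) = 1"
      using complex_norm_square[of "z j"] unit[OF that(2)] by simp
  qed
  have "f k * cnj (f k) = (\<Sum>p\<in>A \<times> A. ?c p * ?w p ^ k)" for k
  proof -
    have "f k * cnj (f k) = (\<Sum>i\<in>A. \<Sum>j\<in>A. b i * z i ^ k * cnj (b j * z j ^ k))"
      by (simp only: f_def cnj_sum sum_product)
    also have "\<dots> = (\<Sum>i\<in>A. \<Sum>j\<in>A. b i * cnj (b j) * (z i * cnj (z j)) ^ k)"
      by (simp add: power_mult_distrib mult_ac)
    finally show ?thesis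
      by (simp only: sum.cartesian_product case_prod_unfold)
  qed
  moreover have "has_mean (\<lambda>k. \<Sum>p\<in>A \<times> A. ?c p * ?w p ^ k)
      (\<Sum>p\<in>A \<times> A. ?c p * (if ?w p = 1 then 1 else 0))"
    by (rule has_mean_exponential_sum) (use unit in \<open>auto simp: norm_mult\<close>)
  moreover have "(\<Sum>p\<in>A \<times> A. ?c p * (if ?w p = 1 then 1 else 0))
      = of_real (\<Sum>j\<in>A. (cmod (b j))\<^sup>2)"
  proof -
    have "(\<Sum>p\<in>A \<times> A. ?c p * (if ?w p = 1 then 1 else 0))
        = (\<Sum>i\<in>A. \<Sum>j\<in>A. b i * cnj (b j) * (if z i * cnj (z j) = 1 then 1 else 0))"
      by (simp add: sum.cartesian_product case_prod_unfold)
    also have "\<dots> = (\<Sum>i\<in>A. \<Sum>j\<in>A. if i = j then b i * cnj (b j) else 0)"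
      by (intro sum.cong refl) (simp add: diag)
    also have "\<dots> = (\<Sum>i\<in>A. b i * cnj (b i))"
      using \<open>finite A\<close> by simp
    finally show ?thesis
      by (simp only: of_real_sum complex_norm_square)
  qed
  ultimately show ?thesis
    by (simp only:)
qed

text \<open>
  Averaging the eventually nonnegative quantity \<open>(f k - d) * (B - f k)\<close> turns a lower bound
  \<open>d\<close> for \<open>f\<close> into the inequality \<open>d * B \<le> - S\<close>.
\<close>

lemma liminf_real_exponential_sum_le:
  fixes b z :: "'a \<Rightarrow> complex"
  assumes "finite A" and pos: "0 < (\<Sum>j\<in>A. cmod (b j))"
    and inj: "inj_on z A"
    and unit: "\<And>j. j \<in> A \<Longrightarrow> cmod (z j) = 1"
    and ne1: "\<And>j. j \<in> A \<Longrightarrow> z j \<noteq> 1"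
    and real: "\<And>k. (\<Sum>j\<in>A. b j * z j ^ k) \<in> \<real>"
  shows "liminf (\<lambda>k. ereal (Re (\<Sum>j\<in>A. b j * z j ^ k)))
      \<le> ereal (- ((\<Sum>j\<in>A. (cmod (b j))\<^sup>2) / (\<Sum>j\<in>A. cmod (b j))))"
proof (rule ccontr)
  define f where "f k = (\<Sum>j\<in>A. b j * z j ^ k)" for k
  define B where "B = (\<Sum>j\<in>A. cmod (b j))"
  define S where "S = (\<Sum>j\<in>A. (cmod (b j))\<^sup>2)"
  assume "\<not> ?thesis"
  then have "ereal (- (S / B)) < liminf (\<lambda>k. ereal (Re (f k)))"
    by (simp add: f_def B_def S_def not_le)
  then obtain d where d: "- (S / B) < d" and "ereal d < liminf (\<lambda>k. ereal (Re (f k)))"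
    using ereal_dense2 by (metis less_ereal.simps(1))
  then have lower: "\<forall>\<^sub>F k in sequentially. d < Re (f k)"
    using less_LiminfD by fastforce
  have upper: "Re (f k) \<le> B" for k
  proof -
    have "cmod (f k) \<le> (\<Sum>j\<in>A. cmod (b j * z j ^ k))"
      unfolding f_def by (rule norm_sum)
    also have "\<dots> = B"
      by (simp add: B_def norm_mult norm_power unit)
    finally show ?thesis
      using complex_Re_le_cmod order_trans by blast
  qed
  have mean: "has_mean (\<lambda>k. Re (f k)) 0"
    using has_mean_Re[OF has_mean_exponential_sum[of A z b]] unit ne1
    by (simp add: f_def cong: sum.cong)
  have "Im (f k) = 0" for k
    using real[of k] by (simp only: f_def complex_is_Real_iff)
  then have "Re (f k * cnj (f k)) = (Re (f k))\<^sup>2" for k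
    by (simp add: power2_eq_square)
  then have mean_square: "has_mean (\<lambda>k. (Re (f k))\<^sup>2) S"
    using has_mean_Re[OF has_mean_norm_square_exponential_sum[OF \<open>finite A\<close> inj unit, of b]]
    by (simp only: S_def Re_complex_of_real flip: f_def)
  \<comment> \<open>The product \<open>(Re (f k) - d) * (B - Re (f k))\<close>, expanded so that linearity of the mean applies.\<close>
  have "has_mean (\<lambda>k. (B + d) * Re (f k) + ((- 1) * (Re (f k))\<^sup>2 + (- d * B)))
      ((B + d) * 0 + ((- 1) * S + (- d * B)))"
    by (intro has_mean_add has_mean_cmult has_mean_const mean mean_square)
  moreover have "(B + d) * Re (f k) + ((- 1) * (Re (f k))\<^sup>2 + (- d * B))
      = (Re (f k) - d) * (B - Re (f k))" for k
    by (simp add: algebra_simps power2_eq_square)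
  ultimately have "has_mean (\<lambda>k. (Re (f k) - d) * (B - Re (f k))) (- S - d * B)"
    by simp
  moreover have "\<forall>\<^sub>F k in sequentially. 0 \<le> (Re (f k) - d) * (B - Re (f k))"
    using lower by eventually_elim (simp add: upper)
  ultimately have "0 \<le> - S - d * B"
    by (rule has_mean_nonneg)
  moreover have "- S < d * B"
    using d pos by (simp add: B_def[symmetric] field_simps)
  ultimately show False
    by simp
qed

theorem theorem1:
  fixes n :: nat and b z :: "nat \<Rightarrow> complex"
  assumes "n \<ge> 1"
    and "\<And>i. i \<in> {1..n} \<Longrightarrow> b i \<noteq> 0"
    and "\<And>i. i \<in> {1..n} \<Longrightarrow> b (n + 1 - i) = cnj (b i)"
    and "inj_on z {1..n}"
    and "\<And>i. i \<in> {1..n} \<Longrightarrow> cmod (z i) = 1"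
    and "\<And>i. i \<in> {1..n} \<Longrightarrow> z i \<noteq> 1"
    and "\<And>i. i \<in> {1..n} \<Longrightarrow> z (n + 1 - i) = cnj (z i)"
  shows "liminf (\<lambda>k. ereal (Re (\<Sum>j=1..n. b j * z j ^ k)))
      \<le> ereal (- ((\<Sum>j=1..n. (cmod (b j))\<^sup>2) / (\<Sum>j=1..n. cmod (b j))))"
proof (rule liminf_real_exponential_sum_le)
  show "0 < (\<Sum>j=1..n. cmod (b j))"
    using assms(1,2) by (intro sum_pos) auto
  show "(\<Sum>j=1..n. b j * z j ^ k) \<in> \<real>" for k
    using assms(3,7) by (rule conjugate_symmetric_power_sum_real)
qed (use assms(4-6) in auto)

end
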